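(* Let $r$ be an odd positive integer and $q$ a positive integer. Let $g(a)=\frac{\pi}{4}\cdot\frac{1+\tan(\frac\pi4a)}{1-\tan(\frac\pi4a)}$ for $a\in(-1,1)$. Then $$\sum_{m=0}^\infty(-1)^m\left(\sum_{l=mq+1}^{(m+1)q}\frac{1}{(2l-1)^r}\right)=\frac{1}{(r-1)!\,q^r}\sum_{k=0}^{q-1}g^{(r-1)}\Big(\frac{q-1-2k}{q}\Big).$$ That is, the sum of the reciprocals of the $r$-th powers of the odd positive integers, with signs alternating in consecutive blocks of length $q$ (the first block being positive), equals the right-hand side.
   Context: $g^{(r-1)}$ denotes the $(r-1)$-th derivative of $g$, with $g^{(0)}=g$. *)

theory Defs
  imports "HOL-Analysis.Analysis"
begin

(* Only meaningful on the open interval (-1,1), the domain of g in the theorem.  Every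
   point at which g or one of its iterated derivatives is taken lies in that open interval,
   so the values outside it do not matter. *)
definition g :: "real \<Rightarrow> real" where
  "g a = pi / 4 * ((1 + tan (pi / 4 * a)) / (1 - tan (pi / 4 * a)))"

end

theory Submission
  imports Defs "HOL-Probability.Characteristic_Functions"
begin

text \<open>
  Since \<open>g a = (\<pi>/4) tan (\<pi>/4 + \<pi> a/4) = (\<pi>/4) cot (\<pi> (1 - a)/4)\<close>, the function \<open>g\<close> has the
  partial fraction expansion \<open>g a = (\<Sum>n. 1 / (4 n + 1 - a) - 1 / (4 n + 3 + a))\<close>.
  Differentiating it \<open>r - 1\<close> times, where \<open>r - 1\<close> is even, yields \<open>(r - 1)!\<close> times the same series
  with both denominators raised to the power \<open>r\<close>.
  At \<open>a = (q - 1 - 2 k) / q\<close> the denominators become \<open>(4 n q + 2 k + 1) / q\<close> and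
  \<open>(4 n q + 4 q - 1 - 2 k) / q\<close>; as \<open>k\<close> runs from \<open>0\<close> to \<open>q - 1\<close>, their numerators run through the
  odd numbers of the blocks \<open>2 n\<close> and \<open>2 n + 1\<close>, the second block in reverse order. So the sum over
  \<open>k\<close> is the block series with its blocks taken in pairs, and as the blocks tend to zero
  (\<open>block_sum_tendsto_0\<close>) the pairs may be separated (\<open>sums_ungroup_pairs\<close>).

  Term-by-term differentiation is obtained from the Polygamma functions: the reflection formula of
  the Digamma function turns \<open>g\<close> into a difference of two Digamma values (\<open>g_eq_Digamma\<close>), whose
  derivatives are Polygamma values (\<open>higher_deriv_g\<close>) with known series
  (\<open>higher_deriv_g_sums\<close>).
\<close>

section \<open>Reflection formula for the Digamma function\<close>

text \<open>This is the derivative of \<open>rGamma z * rGamma (1 - z) = sin (\<pi> z) / \<pi>\<close>.\<close>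

lemma Digamma_reflection_complex:
  fixes z :: complex
  assumes "z \<notin> \<int>"
  shows "Digamma (1 - z) - Digamma z = of_real pi * cot (of_real pi * z)"
proof -
  have nz: "z \<notin> \<int>\<^sub>\<le>\<^sub>0"
    using assms nonpos_Ints_Int by blast
  have nz1: "1 - z \<notin> \<int>\<^sub>\<le>\<^sub>0"
    using assms nonpos_Ints_Int Ints_diff Ints_1 by (metis diff_diff_eq2 add_diff_cancel_left')
  have rprod: "rGamma z * rGamma (1 - z) = sin (of_real pi * z) / of_real pi"
    by (rule rGamma_reflection_complex)
  have "((\<lambda>w. rGamma w * rGamma (1 - w)) has_field_derivative
          rGamma z * rGamma (1 - z) * (Digamma (1 - z) - Digamma z)) (at z)"
    using nz nz1 by (auto intro!: derivative_eq_intros simp: algebra_simps)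
  moreover have "((\<lambda>w. rGamma w * rGamma (1 - w)) has_field_derivative cos (of_real pi * z)) (at z)"
    unfolding rGamma_reflection_complex by (auto intro!: derivative_eq_intros)
  ultimately have "rGamma z * rGamma (1 - z) * (Digamma (1 - z) - Digamma z) = cos (of_real pi * z)"
    by (rule DERIV_unique)
  moreover have "rGamma z * rGamma (1 - z) \<noteq> 0"
    using nz nz1 by (simp add: rGamma_eq_zero_iff)
  ultimately show ?thesis
    unfolding rprod cot_def by (auto simp: field_simps)
qed

lemma Digamma_reflection_real:
  fixes x :: real
  assumes "x \<notin> \<int>"
  shows "Digamma (1 - x) - Digamma x = pi * cot (pi * x)"
proof -
  have "x \<noteq> 0" "1 - x \<noteq> 0"
    using assms by auto
  have "complex_of_real x \<notin> \<int>"
    using assms by simp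
  from Digamma_reflection_complex[OF this]
  have "complex_of_real (Digamma (1 - x) - Digamma x) = complex_of_real (pi * cot (pi * x))"
    using \<open>x \<noteq> 0\<close> \<open>1 - x \<noteq> 0\<close>
    by (simp flip: Polygamma_of_real add: cot_of_real)
  then show ?thesis
    by (simp only: of_real_eq_iff)
qed

section \<open>Derivatives of \<open>g\<close> and their partial fractions\<close>

lemma g_eq_Digamma:
  assumes "-1 < a" "a < 1"
  shows "g a = (Digamma ((3 + a) / 4) - Digamma ((1 - a) / 4)) / 4"
proof -
  have "(1 - a) / 4 \<notin> \<int>"
  proof
    assume "(1 - a) / 4 \<in> \<int>"
    then obtain n where n: "(1 - a) / 4 = of_int n"
      by (rule Ints_cases)
    have "0 < (1 - a) / 4" "(1 - a) / 4 < 1"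
      using assms by auto
    then show False
      unfolding n
      by simp
  qed
  from Digamma_reflection_real[OF this]
  have "Digamma ((3 + a) / 4) - Digamma ((1 - a) / 4) = pi * cot (pi * ((1 - a) / 4))"
    by (simp add: field_simps)
  also have "pi * ((1 - a) / 4) = pi / 2 - (pi / 4 + pi / 4 * a)"
    by (simp add: field_simps)
  also have "cot \<dots> = tan (pi / 4 + pi / 4 * a)"
    by (simp flip: tan_cot')
  also have "\<dots> = (1 + tan (pi / 4 * a)) / (1 - tan (pi / 4 * a))"
  proof -
    have "- pi < pi * a" "pi * a < pi"
      using assms mult_strict_left_mono[of a 1 pi] mult_strict_left_mono[of "-1" a pi] by auto
    then have "cos (pi / 4 * a) > 0" "cos (pi / 4 + pi / 4 * a) > 0"
      using pi_gt_zero by (intro cos_gt_zero_pi; linarith)+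
    then show ?thesis
      using tan_add[of "pi / 4" "pi / 4 * a"] by (simp add: tan_45 cos_45)
  qed
  finally show ?thesis
    by (simp add: g_def)
qed

lemma higher_deriv_g:
  assumes "-1 < a" "a < 1"
  shows "(deriv ^^ n) g a =
    (Polygamma n ((3 + a) / 4) - (-1) ^ n * Polygamma n ((1 - a) / 4)) / 4 ^ Suc n"
  using assms
proof (induction n arbitrary: a)
  case 0
  then show ?case by (simp add: g_eq_Digamma)
next
  case (Suc n)
  let ?P = "\<lambda>x. (Polygamma n ((3 + x) / 4) - (-1) ^ n * Polygamma n ((1 - x) / 4)) / 4 ^ Suc n"
  have "(3 + a) / 4 \<notin> \<int>\<^sub>\<le>\<^sub>0" "(1 - a) / 4 \<notin> \<int>\<^sub>\<le>\<^sub>0"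
    using Suc.prems by auto
  then have der: "(?P has_field_derivative
      (Polygamma (Suc n) ((3 + a) / 4) - (-1) ^ Suc n * Polygamma (Suc n) ((1 - a) / 4)) / 4 ^ Suc (Suc n)) (at a)"
    by (auto intro!: derivative_eq_intros simp: field_simps)
  have "\<forall>\<^sub>F x in nhds a. x \<in> {-1<..<1}"
    using Suc.prems by (intro eventually_nhds_in_open) auto
  then have "\<forall>\<^sub>F x in nhds a. (deriv ^^ n) g x = ?P x"
    by eventually_elim (use Suc.IH in auto)
  then have "deriv ((deriv ^^ n) g) a = deriv ?P a"
    by (intro deriv_cong_ev refl)
  with DERIV_imp_deriv[OF der] show ?case
    by simp
qed

text \<open>
  For \<open>r = 1\<close> the two Digamma series diverge separately, so that case subtracts the limits
  \<open>ln m - (\<Sum>k<m. 1 / (z + k)) \<longlonglongrightarrow> Digamma z\<close>, in which the logarithms cancel. For \<open>r > 1\<close> each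
  Polygamma series converges. Oddness of \<open>r\<close> is what gives the two series opposite signs.
\<close>

lemma higher_deriv_g_sums:
  assumes "odd r" "-1 < a" "a < 1"
  shows "(\<lambda>n. 1 / (4 * real n + 1 - a) ^ r - 1 / (4 * real n + 3 + a) ^ r) sums
    ((deriv ^^ (r - 1)) g a / fact (r - 1))"
proof -
  define x y where "x = (1 - a) / 4" and "y = (3 + a) / 4"
  have xy: "x > 0" "y > 0"
    using assms by (auto simp: x_def y_def)
  obtain n where r: "r = Suc n" and n: "even n"
    using assms(1) by (cases r) auto
  have "(\<lambda>k. inverse ((x + real k) ^ r) - inverse ((y + real k) ^ r)) sums
      ((Polygamma n y - Polygamma n x) / fact n)"
  proof (cases "n = 0")
    case True
    have lim: "(\<lambda>m. ln (real m) - (\<Sum>k<m. inverse (z + real k))) \<longlonglongrightarrow> Digamma z" if "z > 0" for z :: real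
      using Digamma_LIMSEQ[of z] that by simp
    from tendsto_diff[OF lim[OF xy(2)] lim[OF xy(1)]] show ?thesis
      by (simp add: sums_def True r sum_subtractf)
  next
    case False
    then show ?thesis
      using sums_diff[OF Polygamma_LIMSEQ[of x n] Polygamma_LIMSEQ[of y n]] xy n r
      by (simp add: diff_divide_distrib)
  qed
  from sums_divide[OF this, of "4 ^ r"]
  have "(\<lambda>k. (inverse ((x + real k) ^ r) - inverse ((y + real k) ^ r)) / 4 ^ r) sums
      ((Polygamma n y - Polygamma n x) / 4 ^ r / fact n)"
    by (simp add: mult.commute)
  also have "(\<lambda>k. (inverse ((x + real k) ^ r) - inverse ((y + real k) ^ r)) / 4 ^ r) =
      (\<lambda>k. 1 / (4 * real k + 1 - a) ^ r - 1 / (4 * real k + 3 + a) ^ r)"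
  proof
    fix k
    have eqs: "4 * real k + 1 - a = (x + real k) * 4" "4 * real k + 3 + a = (y + real k) * 4"
      by (simp_all add: x_def y_def)
    show "(inverse ((x + real k) ^ r) - inverse ((y + real k) ^ r)) / 4 ^ r =
        1 / (4 * real k + 1 - a) ^ r - 1 / (4 * real k + 3 + a) ^ r"
      unfolding eqs power_mult_distrib by (simp add: inverse_eq_divide diff_divide_distrib)
  qed
  also have "(Polygamma n y - Polygamma n x) / 4 ^ r = (deriv ^^ (r - 1)) g a"
    using higher_deriv_g[OF assms(2,3), of n] n by (simp add: r x_def y_def)
  finally show ?thesis
    by (simp add: r)
qed

section \<open>Alternating sums over blocks\<close>

text \<open>
  The partial sums of even length converge by the first assumption; those of odd length differ from
  them by a single term, which tends to zero.
\<close>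

lemma sums_ungroup_pairs:
  fixes f :: "nat \<Rightarrow> 'a :: real_normed_vector"
  assumes "(\<lambda>n. f (2 * n) + f (2 * n + 1)) sums s" and "f \<longlonglongrightarrow> 0"
  shows "f sums s"
proof -
  let ?S = "\<lambda>n. \<Sum>i<n. f i"
  have "(\<Sum>i<n. f (2 * i) + f (2 * i + 1)) = ?S (2 * n)" for n
    by (induction n) auto
  with assms(1) have even: "(\<lambda>n. ?S (2 * n)) \<longlonglongrightarrow> s"
    by (simp add: sums_def)
  have "(\<lambda>n. f (2 * n)) \<longlonglongrightarrow> 0"
    using assms(2) by (rule filterlim_compose) (intro filterlim_subseq strict_monoI, simp)
  from tendsto_add[OF even this] have odd: "(\<lambda>n. ?S (2 * n + 1)) \<longlonglongrightarrow> s"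
    by simp
  show ?thesis
    unfolding sums_def using even odd by (rule limseq_even_odd)
qed

text \<open>
  A block has the fixed number \<open>q\<close> of terms, and each term of block \<open>m\<close> is at most \<open>1 / (m + 1)\<close>.
\<close>

lemma block_sum_tendsto_0:
  fixes r q :: nat
  assumes "r > 0"
  shows "(\<lambda>m. \<Sum>l = m * q + 1..(m + 1) * q. 1 / (2 * real l - 1) ^ r) \<longlonglongrightarrow> 0"
proof -
  have "(\<lambda>m. \<Sum>l = m * q + 1..(m + 1) * q. 1 / (2 * real l - 1) ^ r) =
      (\<lambda>m. \<Sum>k<q. 1 / (2 * real (m * q + k + 1) - 1) ^ r)"
  proof
    fix m
    show "(\<Sum>l = m * q + 1..(m + 1) * q. 1 / (2 * real l - 1) ^ r) =
        (\<Sum>k<q. 1 / (2 * real (m * q + k + 1) - 1) ^ r)"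
      by (rule sum.reindex_bij_witness[of _ "\<lambda>k. m * q + k + 1" "\<lambda>l. l - (m * q + 1)"]) auto
  qed
  moreover have "(\<lambda>m. 1 / (2 * real (m * q + k + 1) - 1) ^ r) \<longlonglongrightarrow> 0" if "k < q" for k
  proof (rule tendsto_sandwich[OF _ _ tendsto_const LIMSEQ_inverse_real_of_nat])
    have "1 / (2 * real (m * q + k + 1) - 1) ^ r \<le> inverse (real (Suc m))" for m
    proof -
      have "real m \<le> real (m * q)"
        unfolding of_nat_le_iff using that by simp
      then have "real (Suc m) \<le> 2 * real (m * q + k + 1) - 1"
        by simp
      also have "\<dots> \<le> (2 * real (m * q + k + 1) - 1) ^ r"
        using assms by (intro self_le_power) auto
      finally show ?thesis
        by (simp add: inverse_eq_divide frac_le)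
    qed
    then show "\<forall>\<^sub>F m in sequentially. 1 / (2 * real (m * q + k + 1) - 1) ^ r \<le> inverse (real (Suc m))"
      by simp
  qed simp
  ultimately show ?thesis
    by (auto intro!: tendsto_null_sum simp del: of_nat_add of_nat_mult)
qed

section \<open>The alternating block series\<close>

theorem mainTheorem7:
  fixes r q :: nat
  assumes "r > 0" and "odd r" and "q > 0"
  shows "(\<lambda>m::nat. (- 1) ^ m * (\<Sum>l = m * q + 1..(m + 1) * q. 1 / (2 * real l - 1) ^ r))
    sums (1 / (fact (r - 1) * real q ^ r) *
      (\<Sum>k = 0..q - 1. (deriv ^^ (r - 1)) g ((real q - 1 - 2 * real k) / real q)))"
proof -
  let ?B = "\<lambda>m. \<Sum>l = m * q + 1..(m + 1) * q. 1 / (2 * real l - 1) ^ r"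
  let ?a = "\<lambda>k. (real q - 1 - 2 * real k) / real q"
  have qa: "real q * ?a k = real q - 1 - 2 * real k" for k
    using assms(3) by simp
  have "(\<lambda>m. (- 1) ^ m * f m) \<longlonglongrightarrow> 0" if "f \<longlonglongrightarrow> 0" for f :: "nat \<Rightarrow> real"
    using that by (subst tendsto_norm_zero_iff[symmetric]) (simp add: abs_mult tendsto_rabs_zero)
  from this[OF block_sum_tendsto_0[OF assms(1)]]
  have lim: "(\<lambda>m. (- 1) ^ m * ?B m) \<longlonglongrightarrow> 0" .
  have "(\<lambda>n. 1 / real q ^ r * (\<Sum>k = 0..q - 1.
        1 / (4 * real n + 1 - ?a k) ^ r - 1 / (4 * real n + 3 + ?a k) ^ r)) sums
      (1 / real q ^ r * (\<Sum>k = 0..q - 1. (deriv ^^ (r - 1)) g (?a k) / fact (r - 1)))"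
  proof (rule sums_mult, rule sums_sum, rule higher_deriv_g_sums[OF assms(2)])
    fix k assume "k \<in> {0..q - 1}"
    then have "real k + 1 \<le> real q"
      using assms(3) by auto
    then show "- 1 < ?a k" "?a k < 1"
      using assms(3) by (auto simp: field_simps)
  qed
  also have "1 / real q ^ r * (\<Sum>k = 0..q - 1. (deriv ^^ (r - 1)) g (?a k) / fact (r - 1)) =
      1 / (fact (r - 1) * real q ^ r) * (\<Sum>k = 0..q - 1. (deriv ^^ (r - 1)) g (?a k))"
    by (simp add: sum_divide_distrib)
  also have "(\<lambda>n. 1 / real q ^ r * (\<Sum>k = 0..q - 1.
        1 / (4 * real n + 1 - ?a k) ^ r - 1 / (4 * real n + 3 + ?a k) ^ r)) =
      (\<lambda>n. (- 1) ^ (2 * n) * ?B (2 * n) + (- 1) ^ (2 * n + 1) * ?B (2 * n + 1))"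
  proof
    fix n
    have even: "(\<Sum>k = 0..q - 1. 1 / (real q * (4 * real n + 1 - ?a k)) ^ r) = ?B (2 * n)"
    proof (rule sum.reindex_bij_witness[of _ "\<lambda>l. l - (2 * n * q + 1)" "\<lambda>k. 2 * n * q + k + 1"])
      fix k
      have "real q * (4 * real n + 1 - ?a k) = 2 * real (2 * n * q + k + 1) - 1"
        unfolding right_diff_distrib distrib_left qa by simp
      then show "1 / (2 * real (2 * n * q + k + 1) - 1) ^ r =
          1 / (real q * (4 * real n + 1 - ?a k)) ^ r"
        by simp
    qed (use assms(3) in auto)
    \<comment> \<open>In the odd-numbered blocks the index \<open>l\<close> decreases as \<open>k\<close> grows.\<close>
    have odd: "(\<Sum>k = 0..q - 1. 1 / (real q * (4 * real n + 3 + ?a k)) ^ r) = ?B (2 * n + 1)"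
    proof (rule sum.reindex_bij_witness[of _ "\<lambda>l. (2 * n + 2) * q - l" "\<lambda>k. (2 * n + 2) * q - k"])
      fix k assume "k \<in> {0..q - 1}"
      then have "k \<le> (2 * n + 2) * q"
        by auto
      then have "real q * (4 * real n + 3 + ?a k) = 2 * real ((2 * n + 2) * q - k) - 1"
        unfolding right_diff_distrib distrib_left qa by (simp add: algebra_simps)
      then show "1 / (2 * real ((2 * n + 2) * q - k) - 1) ^ r =
          1 / (real q * (4 * real n + 3 + ?a k)) ^ r"
        by simp
    qed (use assms(3) in auto)
    have "1 / real q ^ r * (\<Sum>k = 0..q - 1.
        1 / (4 * real n + 1 - ?a k) ^ r - 1 / (4 * real n + 3 + ?a k) ^ r) =
      (\<Sum>k = 0..q - 1. 1 / (real q * (4 * real n + 1 - ?a k)) ^ r) -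
      (\<Sum>k = 0..q - 1. 1 / (real q * (4 * real n + 3 + ?a k)) ^ r)"
      unfolding power_mult_distrib sum_subtractf[symmetric] sum_distrib_left
        right_diff_distrib[of "1 / real q ^ r"]
      by simp
    then show "1 / real q ^ r * (\<Sum>k = 0..q - 1.
        1 / (4 * real n + 1 - ?a k) ^ r - 1 / (4 * real n + 3 + ?a k) ^ r) =
      (- 1) ^ (2 * n) * ?B (2 * n) + (- 1) ^ (2 * n + 1) * ?B (2 * n + 1)"
      unfolding even odd by simp
  qed
  finally have "(\<lambda>n. (- 1) ^ (2 * n) * ?B (2 * n) + (- 1) ^ (2 * n + 1) * ?B (2 * n + 1)) sums
      (1 / (fact (r - 1) * real q ^ r) * (\<Sum>k = 0..q - 1. (deriv ^^ (r - 1)) g (?a k)))" .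
  then show ?thesis
    using lim by (rule sums_ungroup_pairs)
qed

end
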